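(* For any positive integers $n, i_1,\ldots,i_n$, with $N:=i_1+\cdots+i_n$, we have $$\Omega'(i_1,\ldots,i_n)=\frac{1}{2(N+1)}\sum_{k=0}^{n}\Omega'(i_1,\ldots,i_{k-1},\,i_k-1)\;\Omega'(i_{k+1}-1,\,i_{k+2},\ldots,i_n),$$ where for $k=0$ the first factor has the empty argument list (so equals $1$) and for $k=n$ the second factor has the empty argument list (so equals $1$).
   Context: A permutation $\tau$ of $\{0,\ldots,M\}$ is said to increase (resp. decrease) on a set $\{p,\ldots,q\}\subseteq\{0,\ldots,M\}$ if $\tau(j)<\tau(j+1)$ (resp. $\tau(j)>\tau(j+1)$) for every $j=p,\ldots,q-1$ (vacuous when $p=q$). For a finite sequence $a_1,\ldots,a_m$ of nonnegative integers ($m\ge1$), put $M:=a_1+\cdots+a_m$, $t_0:=0$, $t_k:=a_1+\cdots+a_k$. Then $\Omega(a_1,\ldots,a_m)$ denotes the number of permutations of $\{0,\ldots,M\}$ which, for every $k=1,\ldots,m$, increase on $\{t_{k-1},\ldots,t_k\}$ if $k$ is odd and decrease on $\{t_{k-1},\ldots,t_k\}$ if $k$ is even (arguments alternately prescribe increasing and decreasing run lengths, starting with increasing). By convention $\Omega$ with no arguments equals $1$. Further, $\Omega'(a_1,\ldots,a_m):=\Omega(a_1,\ldots,a_m)/(a_1+\cdots+a_m+1)!$, and $\Omega'()=1$. *)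

theory Defs
  imports Complex_Main "HOL-Combinatorics.Permutations"
begin

definition increases_on :: "(nat \<Rightarrow> nat) \<Rightarrow> nat \<Rightarrow> nat \<Rightarrow> bool" where
  "increases_on \<tau> p q \<longleftrightarrow> (\<forall>j\<in>{p..<q}. \<tau> j < \<tau> (j + 1))"

definition decreases_on :: "(nat \<Rightarrow> nat) \<Rightarrow> nat \<Rightarrow> nat \<Rightarrow> bool" where
  "decreases_on \<tau> p q \<longleftrightarrow> (\<forall>j\<in>{p..<q}. \<tau> j > \<tau> (j + 1))"

text \<open>The breakpoint \<open>t\<^sub>k = a\<^sub>1 + \<dots> + a\<^sub>k\<close>; so \<open>breakpoint as (length as)\<close> is
  the total \<open>M\<close>.\<close>

definition breakpoint :: "nat list \<Rightarrow> nat \<Rightarrow> nat" where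
  "breakpoint as k = sum_list (take k as)"

definition run_perms :: "nat list \<Rightarrow> (nat \<Rightarrow> nat) set" where
  "run_perms as = {\<tau>. \<tau> permutes {0..sum_list as} \<and>
     (\<forall>k\<in>{1..length as}.
        (odd k \<longrightarrow> increases_on \<tau> (breakpoint as (k - 1)) (breakpoint as k)) \<and>
        (even k \<longrightarrow> decreases_on \<tau> (breakpoint as (k - 1)) (breakpoint as k)))}"

definition Omega :: "nat list \<Rightarrow> nat" where
  "Omega as = card (run_perms as)"

definition Omega' :: "nat list \<Rightarrow> real" where
  "Omega' as = real (Omega as) / fact (sum_list as + 1)"

text \<open>The conventional values at the empty argument list are what the definitions give.\<close>

lemma Omega_Nil: "Omega [] = 1"
  by (simp add: Omega_def run_perms_def)

lemma Omega'_Nil: "Omega' [] = 1"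
  by (simp add: Omega'_def Omega_Nil)

end

theory Submission
  imports Defs "HOL-Combinatorics.Multiset_Permutations"
begin

text \<open>The greatest entry of a permutation with prescribed runs sits at a peak, i.e. at a breakpoint
  \<open>t\<^sub>k\<close> with \<open>k\<close> odd, and the least entry at a breakpoint with
  \<open>k\<close> even. Deleting it leaves two independent permutations of sizes \<open>t\<^sub>k\<close> and \<open>N - t\<^sub>k\<close> with shortened
  runs, the entries being distributed in \<open>N choose t\<^sub>k\<close> ways. Summing the decomposition by the
  greatest entry and the one by the least entry counts everything twice and uses every
  breakpoint exactly once.\<close>

section \<open>Ascent patterns of lists\<close>

definition ups :: "'a::linorder list \<Rightarrow> bool list" where
  "ups xs = map2 (<) xs (tl xs)"

lemma ups_Nil [simp]: "ups [] = []"
  and ups_single [simp]: "ups [x] = []"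
  and ups_Cons_Cons [simp]: "ups (x # y # xs) = (x < y) # ups (y # xs)"
  by (simp_all add: ups_def)

lemma length_ups [simp]: "length (ups xs) = length xs - 1"
  by (simp add: ups_def)

lemma ups_append:
  "ups (xs @ ys) = (if xs = [] then ups ys else if ys = [] then ups xs
     else ups xs @ (last xs < hd ys) # ups ys)"
proof (induction xs)
  case (Cons x xs)
  then show ?case by (cases xs; cases ys) auto
qed simp

lemma ups_map_upt: "ups (map f [s..<s + Suc m]) = map (\<lambda>j. f j < f (j + 1)) [s..<s + m]"
proof (induction m arbitrary: s)
  case (Suc m)
  have "[s..<s + Suc (Suc m)] = s # [Suc s..<Suc s + Suc m]"
       "[s..<s + Suc m] = s # [Suc s..<Suc s + m]"
       "[Suc s..<Suc s + Suc m] = Suc s # [Suc (Suc s)..<Suc s + Suc m]"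
    by (simp_all add: upt_rec del: upt_Suc)
  with Suc[of "Suc s"] show ?case by (simp del: upt_Suc)
qed simp

lemma ups_map_strict_mono:
  assumes "strict_mono_on A f" "set xs \<subseteq> A"
  shows "ups (map f xs) = ups xs"
  using assms(2)
proof (induction xs rule: induct_list012)
  case (3 x y zs)
  then show ?case using strict_mono_on_less[OF assms(1), of x y] by simp
qed simp_all

text \<open>Distinctness rules out equal neighbours, which count as a non-ascent both before and
  after applying \<open>f\<close>.\<close>

lemma ups_map_strict_antimono:
  assumes "\<And>x y. x \<in> A \<Longrightarrow> y \<in> A \<Longrightarrow> x < y \<Longrightarrow> f y < f x" "set xs \<subseteq> A" "distinct xs"
  shows "ups (map f xs) = map Not (ups xs)"
  using assms(2,3)
proof (induction xs rule: induct_list012)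
  case (3 x y zs)
  then have "f x < f y \<longleftrightarrow> \<not> x < y"
    using assms(1)[of x y] assms(1)[of y x] by (cases x y rule: linorder_cases) auto
  with 3 show ?case by simp
qed simp_all

section \<open>Counting permutations with a prescribed pattern\<close>

definition ups_perms :: "bool list \<Rightarrow> 'a::linorder set \<Rightarrow> 'a list set" where
  "ups_perms w A = {xs \<in> permutations_of_set A. ups xs = w}"

text \<open>A nonempty list has one entry more than its pattern, hence a ground set that includes
  \<open>length w\<close>.\<close>

definition ups_count :: "bool list \<Rightarrow> nat" where
  "ups_count w = card (ups_perms w {0..length w})"

lemma finite_ups_perms [simp]: "finite (ups_perms w A)"
  by (simp add: ups_perms_def)

lemma ups_perms_Nil_empty [simp]: "ups_perms [] {} = {[]}"
  by (auto simp: ups_perms_def)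

lemma ups_count_Nil [simp]: "ups_count [] = 1"
proof -
  have "ups_perms [] {0..0::nat} = {[0]}"
    by (auto simp: ups_perms_def)
  then show ?thesis by (simp add: ups_count_def)
qed

lemma map_in_permutations_of_set:
  assumes "xs \<in> permutations_of_set A" "inj_on f A"
  shows "map f xs \<in> permutations_of_set (f ` A)"
  using assms by (auto simp: permutations_of_set_def distinct_map)

text \<open>Applying \<open>f\<close> entrywise is injective on lists over \<open>A\<close>.
  Equalities are obtained by using this inequality in both directions. The parameter
  \<open>g\<close> is the identity for increasing \<open>f\<close> and \<open>map Not\<close> for
  decreasing \<open>f\<close>.\<close>

lemma card_ups_perms_le:
  fixes f :: "'a::linorder \<Rightarrow> 'b::linorder"
  assumes "inj_on f A" "\<And>xs. xs \<in> permutations_of_set A \<Longrightarrow> ups (map f xs) = g (ups xs)"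
  shows "card (ups_perms w A) \<le> card (ups_perms (g w) (f ` A))"
proof (rule card_inj_on_le)
  show "inj_on (map f) (ups_perms w A)"
    by (rule inj_on_subset[OF inj_on_mapI[of _ "lists A"]])
       (use assms(1) in \<open>auto simp: ups_perms_def permutations_of_set_def intro: inj_on_subset\<close>)
  show "map f ` ups_perms w A \<subseteq> ups_perms (g w) (f ` A)"
    using assms map_in_permutations_of_set by (auto simp: ups_perms_def)
qed simp

text \<open>A pattern sees only the relative order of the entries, so \<open>A\<close> can be
  relabelled by its increasing enumeration \<open>f\<close>; \<open>f\<close> and its inverse
  \<open>g\<close> give the two inequalities.\<close>

lemma card_ups_perms:
  fixes A :: "nat set"
  assumes "finite A" "card A = Suc (length w)"
  shows "card (ups_perms w A) = ups_count w"
proof -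
  define f where "f = (\<lambda>j. sorted_list_of_set A ! j)"
  let ?B = "{0..length w}"
  have mono: "strict_mono_on ?B f"
    unfolding strict_mono_on_def f_def
    using assms strict_sorted_list_of_set[of A]
    by (auto simp: sorted_wrt_iff_nth_less)
  have img: "f ` ?B = A"
  proof -
    have "f ` ?B = f ` {0..<length (sorted_list_of_set A)}" using assms by auto
    also have "\<dots> = set (sorted_list_of_set A)"
      unfolding f_def by (auto simp: set_conv_nth)
    finally show ?thesis using assms by simp
  qed
  define g where "g = the_inv_into ?B f"
  have inj: "inj_on f ?B" using mono by (rule strict_mono_on_imp_inj_on)
  have gA: "g x \<in> ?B" "f (g x) = x" if "x \<in> A" for x
    using that img inj unfolding g_def
    by (auto intro!: the_inv_into_into f_the_inv_into_f simp del: atLeastAtMost_iff)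
  have gimg: "g ` A = ?B"
    using inj img unfolding g_def by (simp flip: img)
  have gmono: "strict_mono_on A g"
    unfolding strict_mono_on_def
    using gA strict_mono_on_less[OF mono] by metis
  have "card (ups_perms w ?B) \<le> card (ups_perms (id w) (f ` ?B))"
    by (rule card_ups_perms_le[OF inj])
       (auto intro!: ups_map_strict_mono[OF mono] simp: permutations_of_set_def)
  moreover have "card (ups_perms w A) \<le> card (ups_perms (id w) (g ` A))"
    by (rule card_ups_perms_le[OF strict_mono_on_imp_inj_on[OF gmono]])
       (auto intro!: ups_map_strict_mono[OF gmono] simp: permutations_of_set_def)
  ultimately show ?thesis
    by (simp add: img gimg ups_count_def)
qed

text \<open>Reflecting the values, \<open>x\<close> to \<open>length v - x\<close>, swaps ascents
  and descents. Negating twice restores the pattern, so one inequality, applied to \<open>w\<close>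
  and to \<open>map Not w\<close>, suffices.\<close>

lemma ups_count_map_Not: "ups_count (map Not w) = ups_count w"
proof -
  have le: "ups_count v \<le> ups_count (map Not v)" for v
  proof -
    let ?f = "\<lambda>x. length v - x" and ?A = "{0..length v}"
    have "card (ups_perms v ?A) \<le> card (ups_perms (map Not v) (?f ` ?A))"
      by (rule card_ups_perms_le[where g = "map Not"])
         (auto intro!: ups_map_strict_antimono[of ?A] inj_onI simp: permutations_of_set_def)
    moreover have "?f ` ?A = ?A"
    proof safe
      fix x assume "x \<in> ?A"
      then show "x \<in> ?f ` ?A" by (intro image_eqI[of _ _ "length v - x"]) auto
    qed simp
    ultimately show ?thesis by (simp add: ups_count_def)
  qed
  from le[of w] le[of "map Not w"] show ?thesis by (simp add: comp_def)
qed

section \<open>Decomposition at the greatest entry\<close>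

definition peak :: "bool list \<Rightarrow> nat \<Rightarrow> bool" where
  "peak w p \<longleftrightarrow> (p = 0 \<or> w ! (p - 1)) \<and> (p = length w \<or> \<not> w ! p)"

lemma ups_append_greatest:
  assumes "\<And>x. x \<in> set ys \<Longrightarrow> x < m" "\<And>x. x \<in> set zs \<Longrightarrow> x < m"
  shows "ups (ys @ m # zs) =
    ups ys @ (if ys = [] then [] else [True]) @ (if zs = [] then [] else [False]) @ ups zs"
  using assms(1)[of "last ys"] assms(2)[of "hd zs"]
  by (cases zs; auto simp: ups_append not_less)

text \<open>The greatest entry forces an ascent into it and a descent out of it. These use up the
  letters at \<open>length ys - 1\<close> and \<open>length ys\<close>; the prefix before them and
  the suffix after them are left for the two sides.\<close>

lemma ups_append_greatest_iff:
  assumes "\<And>x. x \<in> set ys \<Longrightarrow> x < m" "\<And>x. x \<in> set zs \<Longrightarrow> x < m"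
    and len: "length ys + length zs = length w"
  shows "ups (ys @ m # zs) = w \<longleftrightarrow>
    peak w (length ys) \<and> ups ys = take (length ys - 1) w \<and> ups zs = drop (length ys + 1) w"
proof -
  \<comment> \<open>\<open>a\<close> and \<open>b\<close> hold the letters of \<open>w\<close>
    adjacent to \<open>m\<close>, and are empty when that side is empty. The four blocks match those
    of \<open>ups (ys @ m # zs)\<close> in length, so the equation of words splits
    blockwise.\<close>
  define u where "u = take (length ys - 1) w"
  define v where "v = drop (length ys + 1) w"
  define a where "a = (if ys = [] then [] else [w ! (length ys - 1)])"
  define b where "b = (if zs = [] then [] else [w ! length ys])"
  have lu: "length u = length ys - 1" and lv: "length v = length zs - 1"
    using len by (auto simp: u_def v_def)
  have "take (length ys) w = u @ a"
    using len by (cases ys) (auto simp: u_def a_def take_Suc_conv_app_nth)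
  moreover have "drop (length ys) w = b @ v"
    using len by (cases zs) (auto simp: v_def b_def Cons_nth_drop_Suc)
  ultimately have w: "w = u @ a @ b @ v"
    by (metis append.assoc append_take_drop_id)
  have pk: "peak w (length ys) \<longleftrightarrow>
    a = (if ys = [] then [] else [True]) \<and> b = (if zs = [] then [] else [False])"
    using len by (auto simp: peak_def a_def b_def)
  have ups: "ups (ys @ m # zs) =
    ups ys @ (if ys = [] then [] else [True]) @ (if zs = [] then [] else [False]) @ ups zs"
    using assms(1,2) by (rule ups_append_greatest)
  have "ups (ys @ m # zs) = u @ a @ b @ v \<longleftrightarrow> ups ys = u \<and>
    (if ys = [] then [] else [True]) = a \<and> (if zs = [] then [] else [False]) = b \<and> ups zs = v"
    unfolding ups
    using lu by (cases "ys = []"; cases "zs = []") (auto simp: a_def b_def)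
  then show ?thesis
    unfolding w[symmetric] pk u_def[symmetric] v_def[symmetric] by blast
qed

text \<open>Choose the set \<open>B\<close> of the \<open>p\<close> entries left of the greatest
  one; the two sides are then arranged independently, in numbers of ways depending only on their
  patterns.\<close>

lemma card_ups_perms_peak:
  assumes p: "p \<le> length w" and m: "m = length w"
  shows "card {xs \<in> ups_perms w {0..m}. xs ! p = m} =
    (if peak w p then (length w choose p) * ups_count (take (p - 1) w) * ups_count (drop (p + 1) w)
     else 0)"
proof -
  let ?A = "{..<m}"
  \<comment> \<open>The set of left entries is recorded explicitly so that the choices form a
    dependent sum. It is determined by \<open>ys\<close>, so \<open>h\<close> can forget it and
    still be injective.\<close>
  define S where "S = (SIGMA B:{B. B \<subseteq> ?A \<and> card B = p}.
    ups_perms (take (p - 1) w) B \<times> ups_perms (drop (p + 1) w) (?A - B))"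
  define h where "h = (\<lambda>(B :: nat set, ys, zs). ys @ m # zs)"
  have key: "ys @ m # zs \<in> ups_perms w {0..m} \<longleftrightarrow>
      peak w p \<and> (set ys, ys, zs) \<in> S" if "length ys = p" for ys zs
  proof -
    have "ys @ m # zs \<in> permutations_of_set {0..m} \<longleftrightarrow>
      set ys \<subseteq> ?A \<and> distinct ys \<and> distinct zs \<and> set zs = ?A - set ys" (is "?L = ?R")
    proof
      assume L: ?L
      then have *: "set ys \<union> insert m (set zs) = {0..m}" "distinct (ys @ m # zs)"
        by (auto simp: permutations_of_set_def)
      have "set ys \<union> set zs = ?A"
      proof -
        have "set ys \<union> set zs = (set ys \<union> insert m (set zs)) - {m}" using *(2) by auto
        also have "\<dots> = ?A" unfolding *(1) by auto
        finally show ?thesis .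
      qed
      with *(2) show ?R by auto
    next
      assume ?R
      then show ?L by (auto simp: permutations_of_set_def)
    qed
    moreover have "ups (ys @ m # zs) = w \<longleftrightarrow>
      peak w p \<and> ups ys = take (p - 1) w \<and> ups zs = drop (p + 1) w" if R: ?R
    proof -
      have "length zs = m - p"
        using R that \<open>length ys = p\<close> by (metis card_Diff_subset card_lessThan distinct_card finite_set)
      then show ?thesis
        using ups_append_greatest_iff[of ys m zs w] R p m \<open>length ys = p\<close> by auto
    qed
    ultimately show ?thesis
      using that by (auto simp: ups_perms_def S_def permutations_of_set_def distinct_card)
  qed
  have split: "take p xs @ m # drop (Suc p) xs = xs" "length (take p xs) = p"
    if "xs \<in> ups_perms w {0..m}" "m = xs ! p" for xs
  proof -
    from that(1) have "length xs = Suc m"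
      by (auto simp: ups_perms_def permutations_of_set_def dest: distinct_card)
    with p m have "p < length xs" by simp
    then show "take p xs @ m # drop (Suc p) xs = xs" "length (take p xs) = p"
      unfolding that(2) by (simp_all add: id_take_nth_drop[symmetric])
  qed
  show ?thesis
  proof (cases "peak w p")
    case False
    have "xs ! p \<noteq> m" if "xs \<in> ups_perms w {0..m}" for xs
      using that split[of xs] key[of "take p xs" "drop (Suc p) xs"] False by auto
    then have "{xs \<in> ups_perms w {0..m}. xs ! p = m} = {}" by blast
    with False show ?thesis by simp
  next
    case True
    have Sset: "(B, ys, zs) \<in> S \<Longrightarrow> B = set ys \<and> length ys = p" for B ys zs
      by (auto simp: S_def ups_perms_def permutations_of_set_def distinct_card)
    have "bij_betw h S {xs \<in> ups_perms w {0..m}. xs ! p = m}"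
    proof (rule bij_betw_imageI)
      show "inj_on h S"
      proof (rule inj_onI)
        fix s t assume "s \<in> S" "t \<in> S" "h s = h t"
        moreover obtain B ys zs C ys' zs' where "s = (B, ys, zs)" "t = (C, ys', zs')"
          by (metis prod_cases3)
        ultimately show "s = t"
          using Sset[of B ys zs] Sset[of C ys' zs'] by (simp add: h_def)
      qed
      show "h ` S = {xs \<in> ups_perms w {0..m}. xs ! p = m}"
      proof (intro equalityI subsetI)
        fix xs assume "xs \<in> h ` S"
        then obtain B ys zs where "(B, ys, zs) \<in> S" "xs = ys @ m # zs" by (auto simp: h_def)
        with Sset[of B ys zs] key[of ys zs] True
        show "xs \<in> {xs \<in> ups_perms w {0..m}. xs ! p = m}" by auto
      next
        fix xs assume "xs \<in> {xs \<in> ups_perms w {0..m}. xs ! p = m}"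
        then have "xs \<in> ups_perms w {0..m}" "m = xs ! p" by auto
        with split[OF this] key[of "take p xs" "drop (Suc p) xs"]
        show "xs \<in> h ` S"
          by (intro image_eqI[where x = "(set (take p xs), take p xs, drop (Suc p) xs)"])
             (simp_all add: h_def)
      qed
    qed
    then have "card {xs \<in> ups_perms w {0..m}. xs ! p = m} = card S"
      by (simp add: bij_betw_same_card)
    also have "\<dots> = (\<Sum>B\<in>{B. B \<subseteq> ?A \<and> card B = p}.
        ups_count (take (p - 1) w) * ups_count (drop (p + 1) w))"
    proof -
      have 1: "card (ups_perms (take (p - 1) w) B) = ups_count (take (p - 1) w)"
        if "B \<subseteq> ?A" "card B = p" for B
      proof (cases "p = 0")
        case True
        \<comment> \<open>\<open>card_ups_perms\<close> would want a one-element set here. With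
          \<open>B\<close> empty and \<open>take (p - 1) w = []\<close> by truncated subtraction,
          both counts are 1.\<close>
        with that have "B = {}" using finite_subset by fastforce
        with True show ?thesis by simp
      next
        case False
        with that p m show ?thesis by (intro card_ups_perms) (auto intro: finite_subset)
      qed
      have 2: "card (ups_perms (drop (p + 1) w) (?A - B)) = ups_count (drop (p + 1) w)"
        if "B \<subseteq> ?A" "card B = p" for B
      proof -
        have c: "card (?A - B) = m - p"
          using that by (subst card_Diff_subset) (auto intro: finite_subset)
        show ?thesis
        proof (cases "p = m")
          case True
          \<comment> \<open>Symmetrically at the right end: nothing remains to be arranged, and the
            empty pattern counts 1 as well.\<close>
          with c have "?A - B = {}" by (simp only: diff_self_eq_0 card_eq_0_iff) auto
          with True m show ?thesis unfolding \<open>?A - B = {}\<close> by simp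
        next
          case False
          with c p m show ?thesis by (intro card_ups_perms) auto
        qed
      qed
      have "card S = (\<Sum>B\<in>{B. B \<subseteq> ?A \<and> card B = p}.
          card (ups_perms (take (p - 1) w) B \<times> ups_perms (drop (p + 1) w) (?A - B)))"
        unfolding S_def by (intro card_SigmaI) auto
      also have "\<dots> = (\<Sum>B\<in>{B. B \<subseteq> ?A \<and> card B = p}.
          ups_count (take (p - 1) w) * ups_count (drop (p + 1) w))"
        by (rule sum.cong[OF refl], elim CollectE conjE, simp only: card_cartesian_product 1 2)
      finally show ?thesis .
    qed
    also have "\<dots> = (length w choose p) * ups_count (take (p - 1) w) * ups_count (drop (p + 1) w)"
      using n_subsets[of ?A p] m by simp
    finally show ?thesis using True by simp
  qed
qed

text \<open>The greatest entry occurs at exactly one position, and positions that are not peaks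
  contribute nothing.\<close>

lemma ups_count_peaks:
  "ups_count w = (\<Sum>p\<in>{p. p \<le> length w \<and> peak w p}.
     (length w choose p) * ups_count (take (p - 1) w) * ups_count (drop (p + 1) w))"
proof -
  let ?m = "length w"
  let ?X = "\<lambda>p. {xs \<in> ups_perms w {0..?m}. xs ! p = ?m}"
  have len: "length xs = Suc ?m" "distinct xs" "?m \<in> set xs" if "xs \<in> ups_perms w {0..?m}" for xs
    using that by (auto simp: ups_perms_def permutations_of_set_def dest: distinct_card)
  have "ups_perms w {0..?m} = (\<Union>p\<in>{..?m}. ?X p)"
    using len by (auto simp: in_set_conv_nth) (metis atMost_iff less_Suc_eq_le)
  then have "ups_count w = card (\<Union>p\<in>{..?m}. ?X p)" by (simp add: ups_count_def)
  also have "\<dots> = (\<Sum>p\<in>{..?m}. card (?X p))"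
  proof (rule card_UN_disjoint)
    have "p = q" if "xs \<in> ?X p" "xs \<in> ?X q" "p \<le> ?m" "q \<le> ?m" for p q xs
      using that len[of xs] nth_eq_iff_index_eq[of xs p q] by simp
    then show "\<forall>p\<in>{..?m}. \<forall>q\<in>{..?m}. p \<noteq> q \<longrightarrow> ?X p \<inter> ?X q = {}"
      by blast
  qed auto
  also have "\<dots> = (\<Sum>p\<in>{..?m}. if peak w p then (length w choose p) *
      ups_count (take (p - 1) w) * ups_count (drop (p + 1) w) else 0)"
    by (intro sum.cong refl card_ups_perms_peak) auto
  also have "\<dots> = (\<Sum>p\<in>{p. p \<le> length w \<and> peak w p}.
     (length w choose p) * ups_count (take (p - 1) w) * ups_count (drop (p + 1) w))"
    by (subst sum.inter_filter[symmetric]) auto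
  finally show ?thesis .
qed

section \<open>Turning points and the double count\<close>

definition turning :: "bool list \<Rightarrow> nat set" where
  "turning w = {p. p \<le> length w \<and> (p = 0 \<or> p = length w \<or> w ! (p - 1) \<noteq> w ! p)}"

text \<open>Reflection of values turns the expansion by the greatest entry into one by the least,
  indexed by the peaks of \<open>map Not w\<close>, i.e. the valleys of \<open>w\<close>. In a
  nonempty pattern each turning point is exactly one of peak and valley; in the empty pattern
  position 0 would be both.\<close>

lemma ups_count_turning:
  assumes "w \<noteq> []"
  shows "2 * ups_count w = (\<Sum>p\<in>turning w.
     (length w choose p) * ups_count (take (p - 1) w) * ups_count (drop (p + 1) w))"
proof -
  define c where
    "c p = (length w choose p) * ups_count (take (p - 1) w) * ups_count (drop (p + 1) w)" for p
  let ?P = "{p. p \<le> length w \<and> peak w p}" and ?V = "{p. p \<le> length w \<and> peak (map Not w) p}"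
  have V: "peak (map Not w) p \<longleftrightarrow> (p = 0 \<or> \<not> w ! (p - 1)) \<and> (p = length w \<or> w ! p)"
    if "p \<le> length w" for p
    using that by (cases "p = 0"; cases "p = length w") (auto simp: peak_def)
  have excl: "\<not> (peak w p \<and> peak (map Not w) p)"
    and cover: "peak w p \<or> peak (map Not w) p \<longleftrightarrow>
      p = 0 \<or> p = length w \<or> w ! (p - 1) \<noteq> w ! p" if "p \<le> length w" for p
    unfolding V[OF that] peak_def[of w] using assms by auto
  have "ups_count w = sum c ?V"
    using ups_count_peaks[of "map Not w"]
    by (simp add: ups_count_map_Not c_def take_map drop_map)
  moreover have "ups_count w = sum c ?P"
    unfolding c_def by (rule ups_count_peaks)
  moreover have "sum c (?P \<union> ?V) = sum c ?P + sum c ?V"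
    using excl by (intro sum.union_disjoint) auto
  moreover have "?P \<union> ?V = turning w"
    unfolding turning_def using cover by blast
  ultimately show ?thesis by (simp add: c_def)
qed

section \<open>Run lengths as patterns\<close>

primrec runs :: "bool \<Rightarrow> nat list \<Rightarrow> bool list" where
  "runs b [] = []"
| "runs b (a # as) = replicate a b @ runs (\<not> b) as"

lemma length_runs [simp]: "length (runs b as) = sum_list as"
  by (induction as arbitrary: b) auto

lemma runs_append: "runs b (as @ bs) = runs b as @ runs (b = even (length as)) bs"
proof (induction as arbitrary: b)
  case (Cons a as)
  have "((\<not> b) = even (length as)) = (b = even (length (a # as)))" by auto
  with Cons show ?case by simp
qed simp

lemma runs_Not: "runs (\<not> b) as = map Not (runs b as)"
  by (induction as arbitrary: b) (auto simp: comp_def)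

text \<open>\<open>Omega\<close> always begins with an increasing run, whereas the piece right of a
  deleted extremum may begin with a decreasing one; this symmetry reconciles them.\<close>

lemma ups_count_runs: "ups_count (runs b as) = ups_count (runs True as)"
  using ups_count_map_Not[of "runs True as"] by (cases b) (simp_all flip: runs_Not)

lemma breakpoint_Cons_Suc: "breakpoint (a # as) (Suc k) = a + breakpoint as k"
  by (simp add: breakpoint_def)

lemma breakpoint_0 [simp]: "breakpoint as 0 = 0"
  by (simp add: breakpoint_def)

text \<open>The offset \<open>s\<close> and the first letter \<open>b\<close> are kept general for
  the induction: the tail starts at \<open>s + a\<close> with the opposite letter.\<close>

lemma map_upt_eq_runs_iff:
  "map f [s..<s + sum_list as] = runs b as \<longleftrightarrow>
     (\<forall>k<length as. \<forall>j\<in>{s + breakpoint as k..<s + breakpoint as (Suc k)}. f j = (b = even k))"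
proof (induction as arbitrary: s b)
  case (Cons a as)
  have "map f [s..<s + sum_list (a # as)] = map f [s..<s + a] @ map f [s + a..<s + a + sum_list as]"
    using upt_add_eq_append[of s "s + a" "sum_list as"] by (simp add: add.assoc)
  moreover have "map f [s..<s + a] = replicate a b \<longleftrightarrow> (\<forall>j\<in>{s..<s + a}. f j = b)"
  proof -
    have "replicate a b = map (\<lambda>_. b) [s..<s + a]" by (simp add: map_replicate_const)
    then show ?thesis by (simp only: map_eq_conv set_upt)
  qed
  ultimately show ?case
    using Cons[of "s + a" "\<not> b"]
    by (auto simp: All_less_Suc2 breakpoint_Cons_Suc add.assoc)
qed simp

text \<open>A permutation is identified with the list of its values, and its run conditions with the
  pattern of that list.\<close>

lemma Omega_eq_ups_count: "Omega as = ups_count (runs True as)"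
proof -
  let ?M = "sum_list as"
  let ?h = "\<lambda>\<tau>. map \<tau> [0..<Suc ?M]"
  let ?P = "{\<tau>. \<tau> permutes {0..?M}}"
  have inj: "inj_on ?h ?P"
  proof (rule inj_onI)
    fix \<sigma> \<tau> assume st: "\<sigma> \<in> ?P" "\<tau> \<in> ?P" "?h \<sigma> = ?h \<tau>"
    show "\<sigma> = \<tau>"
    proof
      fix x
      show "\<sigma> x = \<tau> x"
        using st by (cases "x \<le> ?M") (auto simp: permutes_not_in)
    qed
  qed
  \<comment> \<open>Surjectivity follows from injectivity together with equal cardinalities.\<close>
  have "?h ` ?P \<subseteq> permutations_of_set {0..?M}"
    by (auto simp: permutations_of_set_def distinct_map permutes_inj_on permutes_image
        atLeast0LessThan lessThan_Suc_atMost atLeast0AtMost simp del: upt_Suc)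
  moreover have "card (?h ` ?P) = card (permutations_of_set {0..?M})"
    using inj by (simp add: card_image card_permutations del: upt_Suc)
  ultimately have img: "?h ` ?P = permutations_of_set {0..?M}"
    by (intro card_subset_eq) auto
  have iff: "\<tau> \<in> run_perms as \<longleftrightarrow> ups (?h \<tau>) = runs True as" if \<tau>: "\<tau> \<in> ?P" for \<tau>
  proof -
    define u where "u j \<longleftrightarrow> \<tau> j < \<tau> (j + 1)" for j
    \<comment> \<open>A permutation has no ties, so a failed ascent is a descent.\<close>
    have gt: "\<tau> j > \<tau> (j + 1) \<longleftrightarrow> \<not> u j" for j
    proof -
      have "inj \<tau>" using \<tau> by (auto intro: permutes_inj)
      then have "\<tau> j \<noteq> \<tau> (j + 1)" by (simp add: inj_eq)
      then show ?thesis unfolding u_def by linarith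
    qed
    have inc: "increases_on \<tau> p q \<longleftrightarrow> (\<forall>j\<in>{p..<q}. u j)"
      and dec: "decreases_on \<tau> p q \<longleftrightarrow> (\<forall>j\<in>{p..<q}. \<not> u j)" for p q
      unfolding increases_on_def decreases_on_def gt by (simp_all only: u_def)
    \<comment> \<open>Runs are numbered from 1 in \<open>run_perms\<close> but from 0 in
      \<open>map_upt_eq_runs_iff\<close>, so the odd (increasing) ones become even.\<close>
    have Ball_Suc: "(\<forall>k\<in>{1..length as}. Q k) \<longleftrightarrow> (\<forall>k<length as. Q (Suc k))" for Q
      by (auto simp: Ball_def Suc_le_eq) (metis Suc_le_eq Suc_pred not_less_eq_eq zero_less_Suc)
    have "\<tau> \<in> run_perms as \<longleftrightarrow> (\<forall>k<length as. \<forall>j\<in>{breakpoint as k..<breakpoint as (Suc k)}.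
        u j = (True = even k))"
      using \<tau> unfolding run_perms_def mem_Collect_eq inc dec Ball_Suc by auto
    moreover have "ups (?h \<tau>) = map u [0..<?M]"
      using ups_map_upt[of \<tau> 0 ?M] by (simp add: u_def del: upt_Suc)
    ultimately show ?thesis
      using map_upt_eq_runs_iff[of u 0 as True] by (simp del: upt_Suc)
  qed
  have "run_perms as \<subseteq> ?P" by (auto simp: run_perms_def)
  then have "?h ` run_perms as = ups_perms (runs True as) {0..?M}"
    unfolding ups_perms_def img[symmetric] using iff by blast
  moreover have "inj_on ?h (run_perms as)"
    using inj \<open>run_perms as \<subseteq> ?P\<close> by (rule inj_on_subset)
  ultimately show ?thesis
    unfolding Omega_def ups_count_def by (metis card_image length_runs)
qed

section \<open>Breakpoints as turning points\<close>

lemma turning_replicate_append: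
  assumes "a > 0" "w = [] \<or> hd w \<noteq> b"
  shows "turning (replicate a b @ w) = insert 0 ((+) a ` turning w)"
proof (rule set_eqI)
  fix p
  consider "p < a" | q where "p = a + q"
    by (metis add_diff_inverse_nat)
  then show "p \<in> turning (replicate a b @ w) \<longleftrightarrow> p \<in> insert 0 ((+) a ` turning w)"
  proof cases
    case 1
    then show ?thesis by (auto simp: turning_def nth_append)
  next
    case 2
    then show ?thesis
      using assms by (cases q) (auto simp: turning_def nth_append hd_conv_nth)
  qed
qed

text \<open>Inside a run the letter is constant. Positive lengths ensure that at each inner
  breakpoint two runs with opposite letters really meet.\<close>

lemma turning_runs:
  assumes "\<forall>a\<in>set as. a > 0"
  shows "turning (runs b as) = breakpoint as ` {0..length as}"
  using assms
proof (induction as arbitrary: b)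
  case Nil
  then show ?case by (auto simp: turning_def)
next
  case (Cons a as)
  have "runs (\<not> b) as = [] \<or> hd (runs (\<not> b) as) \<noteq> b"
    using Cons.prems by (cases as) (auto simp: hd_append)
  then have "turning (runs b (a # as)) = insert 0 ((+) a ` breakpoint as ` {0..length as})"
    using Cons by (simp add: turning_replicate_append)
  also have "\<dots> = breakpoint (a # as) ` {0..length (a # as)}"
    unfolding list.size add_Suc_right add_0_right atLeast0_atMost_Suc_eq_insert_0
    by (simp add: image_image breakpoint_Cons_Suc flip: image_Suc_atLeastAtMost)
  finally show ?case .
qed

text \<open>Positive parts make the partial sums strictly increasing. This lets a sum over turning
  points be reindexed by \<open>k\<close>.\<close>

lemma inj_on_breakpoint:
  assumes "\<forall>a\<in>set as. a > 0"
  shows "inj_on (breakpoint as) {0..length as}"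
proof -
  have "breakpoint as j < breakpoint as k" if "j < k" "k \<le> length as" for j k
  proof -
    \<comment> \<open>A nonempty slice of positive entries, whose sum is the difference of the two
      breakpoints.\<close>
    let ?d = "take (k - j) (drop j as)"
    have "take k as = take j as @ ?d"
      using that by (metis le_add_diff_inverse less_imp_le_nat take_add)
    moreover have "hd ?d \<in> set ?d"
      using that by (intro hd_in_set) simp
    then have "hd ?d \<in> set as"
      by (meson in_set_takeD in_set_dropD)
    with assms \<open>hd ?d \<in> set ?d\<close> have "sum_list ?d > 0"
      by (metis gr0I less_irrefl sum_list_eq_0_iff)
    ultimately show ?thesis by (simp add: breakpoint_def)
  qed
  then show ?thesis
    by (intro linorder_inj_onI') (metis atLeastAtMost_iff less_irrefl)
qed

section \<open>Normalisation by factorials and the recurrence\<close>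

lemma Omega'_recurrence:
  assumes pos: "\<forall>a\<in>set as. a > 0" and "as \<noteq> []"
  shows "2 * (real (sum_list as) + 1) * Omega' as = (\<Sum>k = 0..length as.
    Omega' (if k = 0 then [] else take (k - 1) as @ [as ! (k - 1) - 1]) *
    Omega' (if k = length as then [] else (as ! k - 1) # drop (k + 1) as))"
proof -
  let ?w = "runs True as" and ?N = "sum_list as"
  \<comment> \<open>The runs left and right of the entry at breakpoint \<open>k\<close>; deleting
    that entry costs each adjacent run one step.\<close>
  define L where "L k = (if k = 0 then [] else take (k - 1) as @ [as ! (k - 1) - 1])" for k
  define R where "R k = (if k = length as then [] else (as ! k - 1) # drop (k + 1) as)" for k
  have posn: "as ! k > 0" if "k < length as" for k
    using pos that by simp
  have le: "breakpoint as k \<le> ?N" for k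
    unfolding breakpoint_def by (metis append_take_drop_id le_add1 sum_list_append)
  \<comment> \<open>The second identity compares factorials rather than their arguments: for
    \<open>k = 0\<close> these are 1 and 0, and only 1! = 0! makes them agree. The same happens for
    \<open>R\<close> at \<open>k = length as\<close>.\<close>
  have L: "ups_count (take (breakpoint as k - 1) ?w) = Omega (L k)"
    "fact (sum_list (L k) + 1) = (fact (breakpoint as k) :: real)" if "k \<le> length as" for k
  proof -
    have "take (breakpoint as k - 1) ?w = runs True (L k) \<and>
        fact (sum_list (L k) + 1) = (fact (breakpoint as k) :: real)"
    proof (cases k)
      case (Suc j)
      then have j: "j < length as" "as ! j > 0" using that posn by auto
      define xs ys where "xs = take j as" and "ys = drop (Suc j) as"
      obtain c where c: "as ! j = Suc c" using j(2) by (cases "as ! j") auto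
      have as: "as = xs @ Suc c # ys"
        unfolding xs_def ys_def c[symmetric] using j(1) by (rule id_take_nth_drop)
      have bp: "breakpoint as k = sum_list xs + Suc c"
        using Suc j(1) c by (simp add: breakpoint_def xs_def take_Suc_conv_app_nth)
      have Lk: "L k = xs @ [c]" using Suc c by (simp add: L_def xs_def)
      show ?thesis
        unfolding bp Lk by (subst as) (auto simp: runs_append replicate_append_same[symmetric])
    qed (simp add: L_def)
    then show "ups_count (take (breakpoint as k - 1) ?w) = Omega (L k)"
      "fact (sum_list (L k) + 1) = (fact (breakpoint as k) :: real)"
      by (simp_all add: Omega_eq_ups_count)
  qed
  have R: "ups_count (drop (breakpoint as k + 1) ?w) = Omega (R k)"
    "fact (sum_list (R k) + 1) = (fact (?N - breakpoint as k) :: real)" if "k \<le> length as" for k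
  proof -
    \<comment> \<open>The first letter of the remaining word depends on the parity of
      \<open>k\<close>; it stays existential because \<open>ups_count_runs\<close> makes the count
      independent of it.\<close>
    have "(\<exists>b. drop (breakpoint as k + 1) ?w = runs b (R k)) \<and>
        fact (sum_list (R k) + 1) = (fact (?N - breakpoint as k) :: real)"
    proof (cases "k = length as")
      case False
      with that have k: "k < length as" "as ! k > 0" using posn by auto
      define xs ys where "xs = take k as" and "ys = drop (Suc k) as"
      obtain c where c: "as ! k = Suc c" using k(2) by (cases "as ! k") auto
      have as: "as = xs @ Suc c # ys"
        unfolding xs_def ys_def c[symmetric] using k(1) by (rule id_take_nth_drop)
      have bp: "breakpoint as k = sum_list xs" by (simp add: breakpoint_def xs_def)
      have Rk: "R k = c # ys" using False c by (simp add: R_def ys_def)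
      have "drop (breakpoint as k + 1) ?w = runs (even (length xs)) (R k)"
        unfolding bp Rk by (subst as) (simp add: runs_append)
      moreover have "sum_list (R k) + 1 = ?N - breakpoint as k"
        unfolding bp Rk by (subst as) simp
      ultimately show ?thesis by metis
    qed (simp add: R_def breakpoint_def)
    then show "ups_count (drop (breakpoint as k + 1) ?w) = Omega (R k)"
      "fact (sum_list (R k) + 1) = (fact (?N - breakpoint as k) :: real)"
      by (metis Omega_eq_ups_count ups_count_runs, blast)
  qed
  have "?w \<noteq> []"
    using assms by (cases as) auto
  then have "2 * Omega as = (\<Sum>p\<in>breakpoint as ` {0..length as}.
      (?N choose p) * ups_count (take (p - 1) ?w) * ups_count (drop (p + 1) ?w))"
    using ups_count_turning[of ?w] turning_runs[OF pos, of True] by (simp add: Omega_eq_ups_count)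
  also have "\<dots> = (\<Sum>k = 0..length as. (?N choose breakpoint as k) * Omega (L k) * Omega (R k))"
    unfolding sum.reindex[OF inj_on_breakpoint[OF pos]] comp_def
    by (intro sum.cong refl) (simp only: atLeastAtMost_iff L(1) R(1))
  finally have "2 * real (Omega as) =
      (\<Sum>k = 0..length as. real ((?N choose breakpoint as k) * Omega (L k) * Omega (R k)))"
    by (metis of_nat_mult of_nat_numeral of_nat_sum)
  \<comment> \<open>Division by \<open>fact ?N\<close> turns each binomial coefficient into the
    reciprocal of t! (N - t)! with t = \<open>breakpoint as k\<close>, which are exactly the
    denominators of the two \<open>Omega'\<close> factors.\<close>
  then have "2 * real (Omega as) / fact ?N =
      (\<Sum>k = 0..length as. real ((?N choose breakpoint as k) * Omega (L k) * Omega (R k)) / fact ?N)"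
    by (simp add: sum_divide_distrib)
  also have "\<dots> = (\<Sum>k = 0..length as. Omega' (L k) * Omega' (R k))"
  proof (rule sum.cong[OF refl])
    fix k assume "k \<in> {0..length as}"
    then have k: "k \<le> length as" by simp
    show "real ((?N choose breakpoint as k) * Omega (L k) * Omega (R k)) / fact ?N =
        Omega' (L k) * Omega' (R k)"
      unfolding Omega'_def L(2)[OF k] R(2)[OF k]
      by (simp add: binomial_fact[OF le])
  qed
  \<comment> \<open>\<open>Omega' as\<close> is normalised by (N + 1)! instead of N!, whence the
    factor N + 1.\<close>
  also have "2 * real (Omega as) / fact ?N = 2 * (real ?N + 1) * Omega' as"
  proof -
    have fact: "(fact (?N + 1) :: real) = (real ?N + 1) * fact ?N" by (simp add: add.commute)
    have cancel: "2 * x / f = 2 * c * (x / (c * f))" if "c \<noteq> 0" for c x f :: real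
      using that by simp
    show ?thesis unfolding Omega'_def fact by (rule cancel) linarith
  qed
  finally show ?thesis unfolding L_def R_def .
qed

theorem theorem3:
  fixes n N :: nat and i :: "nat \<Rightarrow> nat"
  assumes "n > 0"
    and "\<And>k. k \<in> {1..n} \<Longrightarrow> i k > 0"
    and "N = (\<Sum>k = 1..n. i k)"
  shows "Omega' (map i [1..<n + 1]) =
    1 / (2 * (real N + 1)) *
    (\<Sum>k = 0..n.
       Omega' (if k = 0 then [] else map i [1..<k] @ [i k - 1]) *
       Omega' (if k = n then [] else (i (k + 1) - 1) # map i [k + 2..<n + 1]))"
proof -
  let ?as = "map i [1..<n + 1]"
  have "?as \<noteq> []" and pos: "\<forall>a\<in>set ?as. a > 0"
    using assms(1,2) by (auto simp del: upt_Suc)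
  have N: "sum_list ?as = N"
    unfolding assms(3) by (simp add: interv_sum_list_conv_sum_set_nat atLeastLessThanSuc_atLeastAtMost del: upt_Suc)
  have "2 * (real N + 1) * Omega' ?as = (\<Sum>k = 0..n.
       Omega' (if k = 0 then [] else map i [1..<k] @ [i k - 1]) *
       Omega' (if k = n then [] else (i (k + 1) - 1) # map i [k + 2..<n + 1]))"
    \<comment> \<open>List positions start at 0 but \<open>i\<close> is indexed from 1: entry
      \<open>k - 1\<close> of \<open>?as\<close> is \<open>i k\<close>, and entry \<open>k\<close>
      is \<open>i (k + 1)\<close>.\<close>
    unfolding Omega'_recurrence[OF pos \<open>?as \<noteq> []\<close>, unfolded N]
    by (intro sum.cong arg_cong2[where f = "(*)"] arg_cong[where f = Omega'])
       (auto simp: take_map drop_map simp del: upt_Suc)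
  then show ?thesis by (simp add: field_simps del: upt_Suc)
qed

end
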